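(* Let $f(\cdot;i):\mathbb{R}^d\to\mathbb{R}$, $i\in[n]$, and $F(w)=\frac1n\sum_{i=1}^n f(w;i)$. Assume: (a) $\mathrm{dom}(F)\neq\emptyset$ and $F_*:=\inf_{w\in\mathbb{R}^d}F(w)>-\infty$; (b) there is $L>0$ such that for every $i\in[n]$ and all $w,w'\in\mathrm{dom}(F)$, $\|\nabla f(w;i)-\nabla f(w';i)\|\le L\|w-w'\|$; (c) there are finite constants $\Theta,\sigma\ge 0$ such that for all $w\in\mathrm{dom}(F)$, $\frac1n\sum_{i=1}^n\|\nabla f(w;i)-\nabla F(w)\|^2\le\Theta\|\nabla F(w)\|^2+\sigma^2$. Let $0\le\beta<1$ and $K:=\max\left\{\frac52,\frac{9(5-3\beta)(\Theta+1)}{1-\beta}\right\}$. Run the SMG algorithm (described in the context), with any choice of permutations $\pi^{(t)}$, momentum weight $\beta$, and diminishing learning rate $\eta_t:=\frac{\gamma}{(t+\lambda)^{1/3}}$, $t\ge1$, for some $\gamma>0$ and $\lambda\ge0$ such that $\eta_1=\frac{\gamma}{(1+\lambda)^{1/3}}\le\frac{1}{L\sqrt K}$. Then, after $T$ epochs with $T\ge2$, $$\mathbb{E}\big[\|\nabla F(\hat w_T)\|^2\big]\le\frac{C_1+C_2\log(T-1+\lambda)}{(T+\lambda)^{2/3}-(1+\lambda)^{2/3}},$$ where $$C_1:=\frac{4[F(\tilde w_0)-F_*]}{(1-\beta)\gamma}+\frac{18\sigma^2L^2(5-3\beta)\gamma^2}{(1-\beta)(1+\lambda)},\qquad C_2:=\frac{9\sigma^2L^2(5-3\beta)\gamma^2}{1-\beta}.$$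 Consequently, the convergence rate of the algorithm is $\mathcal{O}(T^{-2/3}\log(T))$ in the number of epochs $T$.
   Context: $[n]=\{1,\dots,n\}$; $\|\cdot\|$ is the Euclidean norm; $\log$ is the natural logarithm; $\mathbb{E}$ is expectation over all randomness (permutations, if random, and output). Since each $f(\cdot;i)$ is real-valued on $\mathbb{R}^d$, $\mathrm{dom}(F)=\mathbb{R}^d$; each $f(\cdot;i)$ is differentiable. SMG algorithm (Shuffling Momentum Gradient), with parameters $\beta$, number of epochs $T\ge1$, and $\eta_t$: Choose $\tilde w_0\in\mathbb{R}^d$ (deterministic) and set $\tilde m_0:=0$. For $t=1,\dots,T$: set $w_0^{(t)}:=\tilde w_{t-1}$, $m_0^{(t)}:=\tilde m_{t-1}$, $v_0^{(t)}:=0$; generate an arbitrary deterministic or random permutation $\pi^{(t)}$ of $[n]$; for $i=0,\dots,n-1$ put $g_i^{(t)}:=\nabla f(w_i^{(t)};\pi^{(t)}(i+1))$ and $$m_{i+1}^{(t)}:=\beta m_0^{(t)}+(1-\beta)g_i^{(t)},\quad v_{i+1}^{(t)}:=v_i^{(t)}+\tfrac1n g_i^{(t)},\quad w_{i+1}^{(t)}:=w_i^{(t)}-\tfrac{\eta_t}{n}m_{i+1}^{(t)};$$ then set $\tilde w_t:=w_n^{(t)}$ and $\tilde m_t:=v_n^{(t)}$. Output: $\hat w_T\in\{\tilde w_0,\dots,\tilde w_{T-1}\}$ chosen at random (independently of the permutations) with probability $\mathbb{P}[\hat w_T=\tilde w_{t-1}]=\eta_t/\sum_{s=1}^T\eta_s$.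 *)

theory Defs
  imports "HOL-Probability.Probability" "HOL-Library.Landau_Symbols" "HOL-Combinatorics.Permutations"
begin

definition gradient :: "('a::real_inner \<Rightarrow> real) \<Rightarrow> 'a \<Rightarrow> 'a" where
  "gradient f x = (THE D. GDERIV f x :> D)"

lemma gradient_eqI: "gradient f x = D" if "GDERIV f x :> D"
proof -
  have "D' = D" if D': "GDERIV f x :> D'" for D'
  proof -
    have "(\<lambda>h. h \<bullet> D') = (\<lambda>h. h \<bullet> D)"
      using has_derivative_unique D' \<open>GDERIV f x :> D\<close> unfolding gderiv_def by blast
    then show "D' = D"
      by (metis inner_commute vector_eq_rdot)
  qed
  then show ?thesis
    using that unfolding gradient_def by (intro the_equality)
qed

text \<open>The pair \<open>(w_i, v_i)\<close> after \<open>i\<close> inner iterations of an epoch with learning rate \<open>\<eta>\<close>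
  and permutation \<open>p\<close> started at \<open>w_0 = w0\<close>, \<open>v_0 = 0\<close>. The momentum \<open>m0\<close> stays fixed
  during the epoch, so \<open>m_i\<close> need not be part of the state.\<close>

primrec smg_inner ::
  "(nat \<Rightarrow> 'a::real_inner \<Rightarrow> real) \<Rightarrow> nat \<Rightarrow> real \<Rightarrow> real \<Rightarrow> (nat \<Rightarrow> nat) \<Rightarrow> 'a \<Rightarrow> 'a \<Rightarrow> nat \<Rightarrow> 'a \<times> 'a"
where
  "smg_inner f n \<beta> \<eta> p w0 m0 0 = (w0, 0)"
| "smg_inner f n \<beta> \<eta> p w0 m0 (Suc i) =
    (let (w, v) = smg_inner f n \<beta> \<eta> p w0 m0 i;
         g = gradient (f (p (i + 1))) w;
         m = \<beta> *\<^sub>R m0 + (1 - \<beta>) *\<^sub>R g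
     in (w - (\<eta> / real n) *\<^sub>R m, v + (1 / real n) *\<^sub>R g))"

text \<open>The pair of the iterate and the momentum after \<open>t\<close> epochs, where epoch \<open>t \<ge> 1\<close> uses
  learning rate \<open>\<eta> t\<close> and permutation \<open>p t\<close>.\<close>

primrec smg ::
  "(nat \<Rightarrow> 'a::real_inner \<Rightarrow> real) \<Rightarrow> nat \<Rightarrow> real \<Rightarrow> (nat \<Rightarrow> real) \<Rightarrow> (nat \<Rightarrow> nat \<Rightarrow> nat) \<Rightarrow> 'a \<Rightarrow> nat \<Rightarrow> 'a \<times> 'a"
where
  "smg f n \<beta> \<eta> p w0 0 = (w0, 0)"
| "smg f n \<beta> \<eta> p w0 (Suc t) =
    (let (w, m) = smg f n \<beta> \<eta> p w0 t
     in smg_inner f n \<beta> (\<eta> (Suc t)) (p (Suc t)) w m n)"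

text \<open>The randomness of a run with \<open>T\<close> epochs: \<open>\<pi> t\<close> is the (possibly random) permutation of
  epoch \<open>t\<close>, with an arbitrary joint law of \<open>\<pi> 1, \<dots>, \<pi> T\<close>; deterministic permutations are
  constant random variables. The index \<open>\<tau>\<close> selects the output, which is the iterate after
  \<open>\<tau> - 1\<close> epochs.\<close>

definition smg_randomness ::
  "nat \<Rightarrow> (nat \<Rightarrow> real) \<Rightarrow> nat \<Rightarrow> 'w measure \<Rightarrow> (nat \<Rightarrow> 'w \<Rightarrow> nat \<Rightarrow> nat) \<Rightarrow> ('w \<Rightarrow> nat) \<Rightarrow> bool"
where
  "smg_randomness n \<eta> T M \<pi> \<tau> \<longleftrightarrow>
     prob_space M \<and>
     (\<forall>t\<in>{1..T}. \<pi> t \<in> M \<rightarrow>\<^sub>M count_space {p. p permutes {1..n}}) \<and>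
     \<tau> \<in> M \<rightarrow>\<^sub>M count_space {1..T} \<and>
     (\<forall>t\<in>{1..T}. measure M {\<omega> \<in> space M. \<tau> \<omega> = t} = \<eta> t / (\<Sum>s=1..T. \<eta> s)) \<and>
     prob_space.indep_set M
       (sets (vimage_algebra (space M) \<tau> (count_space {1..T})))
       (sets (vimage_algebra (space M) (\<lambda>\<omega>. \<lambda>t\<in>{1..T}. \<pi> t \<omega>)
         (PiM {1..T} (\<lambda>_. count_space {p. p permutes {1..n}}))))"

definition smg_output ::
  "(nat \<Rightarrow> 'a::real_inner \<Rightarrow> real) \<Rightarrow> nat \<Rightarrow> real \<Rightarrow> (nat \<Rightarrow> real) \<Rightarrow> 'a \<Rightarrow>
   (nat \<Rightarrow> 'w \<Rightarrow> nat \<Rightarrow> nat) \<Rightarrow> ('w \<Rightarrow> nat) \<Rightarrow> 'w \<Rightarrow> 'a"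
where
  "smg_output f n \<beta> \<eta> w0 \<pi> \<tau> \<omega> = fst (smg f n \<beta> \<eta> (\<lambda>t. \<pi> t \<omega>) w0 (\<tau> \<omega> - 1))"

end

theory Submission imports Defs "HOL-Real_Asymp.Real_Asymp" begin

text \<open>
  Let \<open>w_t\<close> and \<open>m_t\<close> be the iterate and the momentum after \<open>t\<close> epochs. The momentum is the
  average of the component gradients seen during an epoch, so the whole epoch \<open>t\<close> is one step
  \<open>w_t = w_{t-1} - \<eta>_t d_t\<close> with \<open>d_t = \<beta> m_{t-1} + (1 - \<beta>) m_t\<close>. Such a step decreases \<open>F\<close> by
  \<open>\<eta>_t/2 |\<nabla>F(w_{t-1})|\<^sup>2\<close>, up to \<open>\<eta>_t/2 |d_t - \<nabla>F(w_{t-1})|\<^sup>2\<close> (\<open>inexact_gradient_step\<close>), and by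
  convexity the squared error of \<open>d_t\<close> is at most the \<open>\<beta>\<close>-average of those of \<open>m_{t-1}\<close> and \<open>m_t\<close>.

  Because every component is visited exactly once, \<open>m_t\<close> would be the full gradient if the
  iterates did not move during the epoch; by smoothness its error is therefore bounded by the
  drift inside the epoch, which is \<open>O(\<eta>_t)\<close>. Precisely (\<open>epoch_drift\<close>,
  \<open>epoch_step_and_momentum\<close>), the squared distance of \<open>m_t\<close> to both \<open>\<nabla>F(w_{t-1})\<close> and \<open>\<nabla>F(w_t)\<close>
  is at most \<open>45/14 L\<^sup>2 \<eta>_t\<^sup>2\<close> times
  \<open>\<beta> |m_{t-1} - \<nabla>F(w_{t-1})|\<^sup>2 + (\<Theta> + 1) |\<nabla>F(w_{t-1})|\<^sup>2 + \<sigma>\<^sup>2\<close>.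

  Hence the potential \<open>F(w_t) + 3/5 \<eta>_t \<beta> |m_t - \<nabla>F(w_t)|\<^sup>2\<close> decreases in each epoch after the
  first by at least \<open>(1 - \<beta>)/4 \<eta>_t |\<nabla>F(w_{t-1})|\<^sup>2\<close>, up to \<open>2 L\<^sup>2 \<sigma>\<^sup>2 \<eta>_t\<^sup>3\<close>
  (\<open>epoch_descent\<close>). In the first epoch the momentum is zero, and \<open>first_epoch_descent\<close> obtains
  the same drop, starting from \<open>F(w_0)\<close> alone, by treating it as a gradient step of length
  \<open>(1 - \<beta>) \<eta>_1\<close>. Summing gives \<open>smg_gradient_sum_le\<close> for every choice of permutations. As the
  output index is independent of the permutations, the expectation in question is an average
  over permutation sequences of \<open>(\<Sum>t. \<eta>_t |\<nabla>F(w_{t-1})|\<^sup>2) / (\<Sum>t. \<eta>_t)\<close>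
  (\<open>expectation_random_index_le\<close>), and it remains to estimate \<open>\<Sum>t. \<eta>_t\<close> from below and
  \<open>\<Sum>t. \<eta>_t\<^sup>3\<close> from above.
\<close>

section \<open>Gradients and the descent inequality\<close>

lemma gderiv_gradient:
  fixes f :: "'a::euclidean_space \<Rightarrow> real"
  assumes "f differentiable (at w)"
  shows "GDERIV f w :> gradient f w"
proof -
  obtain D where D: "(f has_derivative D) (at w)"
    using assms unfolding differentiable_def by blast
  interpret D: bounded_linear D
    using D by (rule has_derivative_bounded_linear)
  have "D = (\<lambda>h. h \<bullet> (\<Sum>b\<in>Basis. D b *\<^sub>R b))"
  proof
    fix h
    have "D h = D (\<Sum>b\<in>Basis. (h \<bullet> b) *\<^sub>R b)"
      by (simp add: euclidean_representation)
    also have "\<dots> = (\<Sum>b\<in>Basis. (h \<bullet> b) * D b)"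
      by (simp add: D.sum D.scaleR)
    also have "\<dots> = h \<bullet> (\<Sum>b\<in>Basis. D b *\<^sub>R b)"
      by (simp add: inner_sum_right mult.commute)
    finally show "D h = h \<bullet> (\<Sum>b\<in>Basis. D b *\<^sub>R b)" .
  qed
  with D have "GDERIV f w :> (\<Sum>b\<in>Basis. D b *\<^sub>R b)"
    unfolding gderiv_def by metis
  then show ?thesis
    using gradient_eqI by metis
qed

lemma descent_inequality:
  fixes F :: "'a::real_inner \<Rightarrow> real"
  assumes deriv: "\<And>w. GDERIV F w :> G w"
    and lip: "\<And>w w'. norm (G w - G w') \<le> L * norm (w - w')"
  shows "F (x + h) \<le> F x + G x \<bullet> h + L / 2 * (norm h)\<^sup>2"
proof -
  \<comment> \<open>The claim is that \<open>\<phi>\<close>, the excess of \<open>F\<close> over its quadratic model on the segment, does not increase.\<close>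
  define \<phi> where "\<phi> s = F (x + s *\<^sub>R h) - s * (G x \<bullet> h) - L / 2 * s\<^sup>2 * (norm h)\<^sup>2" for s
  have "\<phi> 1 \<le> \<phi> 0"
  proof (rule DERIV_nonpos_imp_nonincreasing[where f = \<phi> and a = 0 and b = 1])
    fix s :: real assume s: "0 \<le> s" "s \<le> 1"
    have "((\<lambda>s. F (x + s *\<^sub>R h)) has_derivative (\<lambda>t. (t *\<^sub>R h) \<bullet> G (x + s *\<^sub>R h))) (at s)"
      by (rule has_derivative_compose[where g = F and f = "\<lambda>s. x + s *\<^sub>R h", simplified])
         (auto intro!: derivative_eq_intros deriv[unfolded gderiv_def])
    then have "((\<lambda>s. F (x + s *\<^sub>R h)) has_real_derivative h \<bullet> G (x + s *\<^sub>R h)) (at s)"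
      unfolding has_field_derivative_def by (simp add: mult.commute[of _ "h \<bullet> _"])
    then have "(\<phi> has_real_derivative
        h \<bullet> G (x + s *\<^sub>R h) - G x \<bullet> h - L * s * (norm h)\<^sup>2) (at s)"
      unfolding \<phi>_def by (auto intro!: derivative_eq_intros)
    moreover have "h \<bullet> G (x + s *\<^sub>R h) - G x \<bullet> h - L * s * (norm h)\<^sup>2 \<le> 0"
    proof -
      have "h \<bullet> G (x + s *\<^sub>R h) - G x \<bullet> h = (G (x + s *\<^sub>R h) - G x) \<bullet> h"
        by (simp add: inner_diff_left inner_diff_right inner_commute)
      also have "\<dots> \<le> norm (G (x + s *\<^sub>R h) - G x) * norm h"
        by (rule norm_cauchy_schwarz)
      also have "\<dots> \<le> (L * norm (x + s *\<^sub>R h - x)) * norm h"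
        by (intro mult_right_mono lip) auto
      also have "\<dots> = L * s * (norm h)\<^sup>2"
        using s by (simp add: power2_eq_square)
      finally show ?thesis by simp
    qed
    ultimately show "\<exists>y. (\<phi> has_real_derivative y) (at s) \<and> y \<le> 0" by blast
  qed simp
  then show ?thesis by (simp add: \<phi>_def)
qed

text \<open>One gradient-like step along an arbitrary direction \<open>d\<close>: the loss incurred for using
  \<open>d\<close> in place of the gradient is only the squared error.\<close>

lemma inexact_gradient_step:
  fixes F :: "'a::real_inner \<Rightarrow> real"
  assumes deriv: "\<And>w. GDERIV F w :> G w"
    and lip: "\<And>w w'. norm (G w - G w') \<le> L * norm (w - w')"
    and s: "0 \<le> s" "L * s \<le> 1"
  shows "F (x - s *\<^sub>R d) \<le> F x - s / 2 * (norm (G x))\<^sup>2 + s / 2 * (norm (d - G x))\<^sup>2"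
proof -
  have "F (x - s *\<^sub>R d) \<le> F x - s * (G x \<bullet> d) + L / 2 * s\<^sup>2 * (norm d)\<^sup>2"
    using descent_inequality[OF deriv lip, of x "- (s *\<^sub>R d)"]
    by (simp add: power_mult_distrib)
  also have "L / 2 * s\<^sup>2 * (norm d)\<^sup>2 \<le> s / 2 * (norm d)\<^sup>2"
    using mult_right_mono[OF s(2), of "s / 2 * (norm d)\<^sup>2"] s(1)
    by (simp add: power2_eq_square mult_ac)
  also have "F x - s * (G x \<bullet> d) + s / 2 * (norm d)\<^sup>2
      = F x - s / 2 * (norm (G x))\<^sup>2 + s / 2 * (norm (d - G x))\<^sup>2"
    by (simp add: power2_norm_eq_inner inner_diff_left inner_diff_right inner_commute
        algebra_simps)
  finally show ?thesis by simp
qed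

section \<open>Drift of the iterates inside an epoch\<close>

lemma norm_sum_squared_le:
  fixes x :: "'b \<Rightarrow> 'a::real_normed_vector"
  shows "(norm (\<Sum>j\<in>J. x j))\<^sup>2 \<le> real (card J) * (\<Sum>j\<in>J. (norm (x j))\<^sup>2)"
proof -
  have "(norm (\<Sum>j\<in>J. x j))\<^sup>2 \<le> (\<Sum>j\<in>J. norm (x j))\<^sup>2"
    by (intro power_mono norm_sum) auto
  also have "\<dots> \<le> real (card J) * (\<Sum>j\<in>J. (norm (x j))\<^sup>2)"
    using sum_squared_le_sum_of_squares[of "\<lambda>j. norm (x j)" J] by (simp add: mult.commute)
  finally show ?thesis .
qed

lemma norm_add3_squared_le:
  fixes a b c :: "'a::real_normed_vector"
  shows "(norm (a + b + c))\<^sup>2 \<le> 3 * ((norm a)\<^sup>2 + (norm b)\<^sup>2 + (norm c)\<^sup>2)"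
proof -
  have "(norm (a + b + c))\<^sup>2 \<le> (norm a + norm b + norm c)\<^sup>2"
    by (intro power_mono) (auto intro: norm_triangle_le norm_triangle_ineq add_mono)
  also have "\<dots> \<le> 3 * ((norm a)\<^sup>2 + (norm b)\<^sup>2 + (norm c)\<^sup>2)"
    using sum_squares_ge_zero[of "norm a - norm b" "norm b - norm c"]
      zero_le_power2[of "norm a - norm c"]
    by (simp add: power2_eq_square algebra_simps)
  finally show ?thesis .
qed

lemma norm_convex_squared_le:
  fixes a b :: "'a::real_inner"
  assumes "0 \<le> \<beta>" "\<beta> \<le> 1"
  shows "(norm (\<beta> *\<^sub>R a + (1 - \<beta>) *\<^sub>R b))\<^sup>2 \<le> \<beta> * (norm a)\<^sup>2 + (1 - \<beta>) * (norm b)\<^sup>2"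
proof -
  have "\<beta> * (norm a)\<^sup>2 + (1 - \<beta>) * (norm b)\<^sup>2 - (norm (\<beta> *\<^sub>R a + (1 - \<beta>) *\<^sub>R b))\<^sup>2
      = \<beta> * (1 - \<beta>) * (norm (a - b))\<^sup>2"
    by (simp add: power2_norm_eq_inner inner_add_left inner_add_right inner_diff_left
        inner_diff_right inner_commute) (simp add: algebra_simps)
  then show ?thesis
    using assms by (smt (verit) mult_nonneg_nonneg zero_le_power2)
qed

text \<open>The bound on the drift during one epoch with momentum \<open>m\<close>. Here \<open>g i\<close> is the component
  gradient used in step \<open>i\<close>, \<open>h i\<close> is the same component gradient at the initial point \<open>w 0\<close>, and
  \<open>G\<close> is the full gradient there. The reference vector \<open>c\<close>, to which the old momentum is compared,
  is \<open>G\<close> in general but \<open>0\<close> in the first epoch, where \<open>m = 0\<close>.\<close>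

lemma epoch_drift:
  fixes w g h :: "nat \<Rightarrow> 'a::real_inner" and m c G :: 'a
  assumes n: "n \<ge> 1" and \<beta>: "0 \<le> \<beta>" "\<beta> \<le> 1"
    and step: "\<And>i. i < n \<Longrightarrow>
      w (Suc i) = w i - (\<eta> / real n) *\<^sub>R (\<beta> *\<^sub>R m + (1 - \<beta>) *\<^sub>R g i)"
    and lip: "\<And>i. i < n \<Longrightarrow> norm (g i - h i) \<le> L * norm (w i - w 0)"
    and var: "(\<Sum>i<n. (norm (h i - G))\<^sup>2) \<le> real n * V"
    and c: "norm c \<le> norm G"
    and small: "L\<^sup>2 * \<eta>\<^sup>2 \<le> 1 / 45"
    and ik: "i \<le> n" "k \<le> n"
  shows "L\<^sup>2 * (norm (w i - w k))\<^sup>2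
    \<le> 45 / 14 * (L\<^sup>2 * \<eta>\<^sup>2) * (\<beta> * (norm (m - c))\<^sup>2 + V + (norm G)\<^sup>2)"
proof -
  define d where "d j = \<beta> *\<^sub>R m + (1 - \<beta>) *\<^sub>R g j" for j
  define S where "S = (\<Sum>j<n. (norm (d j))\<^sup>2)"
  \<comment> \<open>By Cauchy-Schwarz, \<open>P\<close> bounds all squared distances between iterates of the epoch. In turn
    \<open>P\<close> is bounded by those distances times a small factor, so that they can be absorbed.\<close>
  define P where "P = \<eta>\<^sup>2 / real n * S"
  have n0: "real n > 0" using n by simp
  have ordered: "(norm (w a - w b))\<^sup>2 \<le> P" if "a \<le> b" "b \<le> n" for a b
  proof -
    have diff: "w a - w b = (\<eta> / real n) *\<^sub>R (\<Sum>j=a..<b. d j)"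
      using that
    proof (induction b rule: dec_induct)
      case (step b)
      then have "w a - w b = (\<eta> / real n) *\<^sub>R (\<Sum>j=a..<b. d j)" by simp
      with step \<open>a \<le> b\<close> show ?case
        using assms(4)[of b] by (simp add: d_def scaleR_add_right algebra_simps)
    qed simp
    have "(norm (\<Sum>j=a..<b. d j))\<^sup>2 \<le> real (b - a) * (\<Sum>j=a..<b. (norm (d j))\<^sup>2)"
      using norm_sum_squared_le[of d "{a..<b}"] by simp
    also have "\<dots> \<le> real n * S"
      unfolding S_def using that by (intro mult_mono sum_mono2) (auto intro: sum_nonneg)
    finally have "(\<eta> / real n)\<^sup>2 * (norm (\<Sum>j=a..<b. d j))\<^sup>2 \<le> (\<eta> / real n)\<^sup>2 * (real n * S)"
      by (rule mult_left_mono) simp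
    also have "(\<eta> / real n)\<^sup>2 * (real n * S) = P"
      using n0 by (simp add: P_def power2_eq_square)
    finally show ?thesis
      unfolding diff by (simp add: power_mult_distrib power_divide)
  qed
  have drift: "(norm (w a - w b))\<^sup>2 \<le> P" if "a \<le> n" "b \<le> n" for a b
    using ordered[of a b] ordered[of b a] that by (metis linear norm_minus_commute)
  have single: "(norm (d j))\<^sup>2 \<le> 3 * (\<beta> * (norm (m - c))\<^sup>2 + L\<^sup>2 * P
      + (norm (h j - G))\<^sup>2 + (norm G)\<^sup>2)" if j: "j < n" for j
  proof -
    have "d j = (\<beta> *\<^sub>R (m - c) + (1 - \<beta>) *\<^sub>R (g j - h j)) + (1 - \<beta>) *\<^sub>R (h j - G)
        + (\<beta> *\<^sub>R c + (1 - \<beta>) *\<^sub>R G)"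
      by (simp add: d_def algebra_simps)
    then have "(norm (d j))\<^sup>2 \<le> 3 * ((norm (\<beta> *\<^sub>R (m - c) + (1 - \<beta>) *\<^sub>R (g j - h j)))\<^sup>2
        + (norm ((1 - \<beta>) *\<^sub>R (h j - G)))\<^sup>2 + (norm (\<beta> *\<^sub>R c + (1 - \<beta>) *\<^sub>R G))\<^sup>2)"
      by (metis norm_add3_squared_le)
    moreover have "(norm (\<beta> *\<^sub>R (m - c) + (1 - \<beta>) *\<^sub>R (g j - h j)))\<^sup>2
        \<le> \<beta> * (norm (m - c))\<^sup>2 + L\<^sup>2 * P"
    proof -
      have "(norm (g j - h j))\<^sup>2 \<le> (L * norm (w j - w 0))\<^sup>2"
        using lip[OF j] by (intro power_mono) auto
      also have "\<dots> \<le> L\<^sup>2 * P"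
        using drift[of j 0] j by (simp add: power_mult_distrib mult_left_mono)
      finally have *: "(norm (g j - h j))\<^sup>2 \<le> L\<^sup>2 * P" .
      have "(1 - \<beta>) * (norm (g j - h j))\<^sup>2 \<le> 1 * (norm (g j - h j))\<^sup>2"
        using \<beta> by (intro mult_right_mono) auto
      with * norm_convex_squared_le[OF \<beta>, of "m - c" "g j - h j"] show ?thesis by linarith
    qed
    moreover have "(norm ((1 - \<beta>) *\<^sub>R (h j - G)))\<^sup>2 \<le> (norm (h j - G))\<^sup>2"
      using \<beta> by (intro power_mono) (auto simp: mult_left_le_one_le)
    moreover have "(norm (\<beta> *\<^sub>R c + (1 - \<beta>) *\<^sub>R G))\<^sup>2 \<le> (norm G)\<^sup>2"
    proof -
      have "\<beta> * (norm c)\<^sup>2 \<le> \<beta> * (norm G)\<^sup>2"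
        using c \<beta> by (intro mult_left_mono power_mono) auto
      with norm_convex_squared_le[OF \<beta>, of c G] show ?thesis
        unfolding power2_eq_square left_diff_distrib by linarith
    qed
    ultimately show ?thesis by argo
  qed
  have "S \<le> (\<Sum>j<n. 3 * (\<beta> * (norm (m - c))\<^sup>2 + L\<^sup>2 * P + (norm (h j - G))\<^sup>2 + (norm G)\<^sup>2))"
    unfolding S_def by (intro sum_mono single) auto
  also have "\<dots> = 3 * (real n * (\<beta> * (norm (m - c))\<^sup>2 + L\<^sup>2 * P + (norm G)\<^sup>2)
      + (\<Sum>j<n. (norm (h j - G))\<^sup>2))"
    by (simp add: sum.distrib sum_distrib_left[symmetric] algebra_simps)
  also have "\<dots> \<le> real n * (3 * (\<beta> * (norm (m - c))\<^sup>2 + L\<^sup>2 * P + V + (norm G)\<^sup>2))"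
    using var by (simp add: algebra_simps)
  finally have S: "S / real n \<le> 3 * (\<beta> * (norm (m - c))\<^sup>2 + L\<^sup>2 * P + V + (norm G)\<^sup>2)"
    using n0 by (simp add: divide_le_eq mult.commute)
  define x R where "x = L\<^sup>2 * \<eta>\<^sup>2" and "R = \<beta> * (norm (m - c))\<^sup>2 + V + (norm G)\<^sup>2"
  have "L\<^sup>2 * P = x * (S / real n)"
    by (simp add: P_def x_def)
  also have "\<dots> \<le> x * (3 * (L\<^sup>2 * P + R))"
    using S by (intro mult_left_mono) (auto simp: x_def R_def algebra_simps)
  finally have "L\<^sup>2 * P \<le> 3 * x * R + 3 * (x * (L\<^sup>2 * P))"
    by (simp add: algebra_simps)
  moreover have "x * (L\<^sup>2 * P) \<le> 1 / 45 * (L\<^sup>2 * P)"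
    using small by (intro mult_right_mono) (auto simp: x_def P_def S_def intro!: sum_nonneg mult_nonneg_nonneg divide_nonneg_nonneg)
  \<comment> \<open>\<open>3 / (1 - 3 / 45) = 45 / 14\<close>\<close>
  ultimately have "L\<^sup>2 * P \<le> 45 / 14 * x * R" by argo
  moreover have "L\<^sup>2 * (norm (w i - w k))\<^sup>2 \<le> L\<^sup>2 * P"
    using drift ik by (intro mult_left_mono) auto
  ultimately show ?thesis by (simp add: x_def R_def)
qed


section \<open>One epoch, and the trajectory\<close>

lemma sum_permuted_index:
  fixes \<phi> :: "nat \<Rightarrow> 'b::comm_monoid_add"
  assumes "p permutes {1..n}"
  shows "(\<Sum>i<n. \<phi> (p (Suc i))) = (\<Sum>i=1..n. \<phi> i)"
proof -
  have "(\<Sum>i<n. \<phi> (p (Suc i))) = (\<Sum>i=1..n. \<phi> (p i))"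
    by (rule sum.reindex_bij_witness[of _ "\<lambda>i. i - 1" Suc]) auto
  also have "\<dots> = (\<Sum>i=1..n. \<phi> i)"
    using sum.permute[OF assms, of \<phi>] by (simp add: o_def)
  finally show ?thesis .
qed

lemma norm_average_squared_le:
  fixes x :: "nat \<Rightarrow> 'a::real_normed_vector"
  assumes "n \<ge> 1" "\<And>i. i < n \<Longrightarrow> (norm (x i))\<^sup>2 \<le> B"
  shows "(norm ((1 / real n) *\<^sub>R (\<Sum>i<n. x i)))\<^sup>2 \<le> B"
proof -
  have "(norm (\<Sum>i<n. x i))\<^sup>2 \<le> real n * (\<Sum>i<n. (norm (x i))\<^sup>2)"
    using norm_sum_squared_le[of x "{..<n}"] by simp
  also have "\<dots> \<le> real n * (real n * B)"
    using sum_bounded_above[of "{..<n}" "\<lambda>i. (norm (x i))\<^sup>2" B] assms(2)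
    by (intro mult_left_mono) auto
  finally show ?thesis
    using assms(1) by (simp add: power_mult_distrib power_divide divide_le_eq power2_eq_square mult_ac)
qed

text \<open>A finite average \<open>F\<close> of \<open>L\<close>-smooth functions whose gradients have variance at most
  \<open>\<Theta> |\<nabla>F|\<^sup>2 + \<sigma>\<^sup>2\<close>, together with a momentum weight \<open>\<beta>\<close>.\<close>

locale smooth_finite_sum =
  fixes f :: "nat \<Rightarrow> 'a::euclidean_space \<Rightarrow> real" and F :: "'a \<Rightarrow> real"
    and n :: nat and L \<Theta> \<sigma> \<beta> :: real
  assumes n: "n \<ge> 1"
    and differentiable: "\<And>i w. i \<in> {1..n} \<Longrightarrow> f i differentiable (at w)"
    and F: "F = (\<lambda>w. (1 / real n) * (\<Sum>i=1..n. f i w))"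
    and L: "L > 0"
    and smooth: "\<And>i w w'. i \<in> {1..n} \<Longrightarrow>
      norm (gradient (f i) w - gradient (f i) w') \<le> L * norm (w - w')"
    and \<Theta>: "\<Theta> \<ge> 0"
    and variance: "\<And>w. (1 / real n) * (\<Sum>i=1..n. (norm (gradient (f i) w - gradient F w))\<^sup>2)
      \<le> \<Theta> * (norm (gradient F w))\<^sup>2 + \<sigma>\<^sup>2"
    and \<beta>: "0 \<le> \<beta>" "\<beta> < 1"
begin

lemma gderiv_average: "GDERIV F w :> (1 / real n) *\<^sub>R (\<Sum>i=1..n. gradient (f i) w)"
proof -
  have "((\<lambda>w. \<Sum>i=1..n. f i w) has_derivative (\<lambda>h. \<Sum>i=1..n. h \<bullet> gradient (f i) w)) (at w)"
    using gderiv_gradient[OF differentiable] unfolding gderiv_def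
    by (intro has_derivative_sum) auto
  then have "((\<lambda>w. (1 / real n) * (\<Sum>i=1..n. f i w)) has_derivative
      (\<lambda>h. (1 / real n) * (\<Sum>i=1..n. h \<bullet> gradient (f i) w))) (at w)"
    by (rule has_derivative_mult_right)
  then show ?thesis
    unfolding gderiv_def F by (simp add: inner_sum_right)
qed

lemma gradient_average: "gradient F w = (1 / real n) *\<^sub>R (\<Sum>i=1..n. gradient (f i) w)"
  by (rule gradient_eqI[OF gderiv_average])

lemma gderiv_F: "GDERIV F w :> gradient F w"
  using gderiv_average by (simp add: gradient_average)

lemma gradient_F_lipschitz: "norm (gradient F w - gradient F w') \<le> L * norm (w - w')"
proof -
  have "norm (gradient F w - gradient F w')
      = (1 / real n) * norm (\<Sum>i=1..n. gradient (f i) w - gradient (f i) w')"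
    by (simp add: gradient_average sum_subtractf flip: scaleR_diff_right)
  also have "\<dots> \<le> (1 / real n) * (\<Sum>i=1..n. L * norm (w - w'))"
    by (intro mult_left_mono sum_norm_le smooth) auto
  also have "\<dots> = L * norm (w - w')"
    using n by simp
  finally show ?thesis .
qed

text \<open>Seen from outside, an epoch is a single step along a convex combination of the old and the
  new momentum, and the new momentum approximates the full gradient at both ends of the epoch.
  The estimate at the initial point serves the current epoch, that at the final point the next
  one. For \<open>c\<close> see \<open>epoch_drift\<close>.\<close>

lemma epoch_step_and_momentum:
  assumes p: "p permutes {1..n}" and small: "L\<^sup>2 * \<eta>\<^sup>2 \<le> 1 / 45"
    and c: "norm c \<le> norm (gradient F w)"
    and epoch: "smg_inner f n \<beta> \<eta> p w m n = (w', m')"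
  defines "B \<equiv> 45 / 14 * (L\<^sup>2 * \<eta>\<^sup>2) *
    (\<beta> * (norm (m - c))\<^sup>2 + ((\<Theta> + 1) * (norm (gradient F w))\<^sup>2 + \<sigma>\<^sup>2))"
  shows "w' = w - \<eta> *\<^sub>R (\<beta> *\<^sub>R m + (1 - \<beta>) *\<^sub>R m')"
    and "(norm (m' - gradient F w))\<^sup>2 \<le> B"
    and "(norm (m' - gradient F w'))\<^sup>2 \<le> B"
proof -
  define W where "W i = fst (smg_inner f n \<beta> \<eta> p w m i)" for i
  define g where "g i = gradient (f (p (i + 1))) (W i)" for i
  define h where "h i = gradient (f (p (i + 1))) w" for i
  have n0: "real n > 0" using n by simp
  have W0: "W 0 = w" and Wn: "W n = w'"
    using epoch by (simp_all add: W_def)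
  have step: "W (Suc i) = W i - (\<eta> / real n) *\<^sub>R (\<beta> *\<^sub>R m + (1 - \<beta>) *\<^sub>R g i)" for i
    by (simp add: W_def g_def case_prod_beta Let_def)
  have "snd (smg_inner f n \<beta> \<eta> p w m i) = (1 / real n) *\<^sub>R (\<Sum>j<i. g j)" for i
    by (induction i) (simp_all add: W_def g_def case_prod_beta Let_def scaleR_add_right)
  from this[of n] have m': "m' = (1 / real n) *\<^sub>R (\<Sum>j<n. g j)"
    using epoch by simp
  have "W i = w - (\<eta> / real n) *\<^sub>R (\<Sum>j<i. \<beta> *\<^sub>R m + (1 - \<beta>) *\<^sub>R g j)" for i
  proof (induction i)
    case (Suc i)
    then show ?case by (simp add: step scaleR_add_right)
  qed (simp add: W0)
  from this[of n] show "w' = w - \<eta> *\<^sub>R (\<beta> *\<^sub>R m + (1 - \<beta>) *\<^sub>R m')"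
    using n0 unfolding Wn m'
    by (simp add: sum.distrib sum_constant_scaleR scaleR_add_right flip: scaleR_sum_right)
  have in_range: "p (i + 1) \<in> {1..n}" if "i < n" for i
    using permutes_in_image[OF p, of "i + 1"] that by simp
  have drift: "L\<^sup>2 * (norm (W i - W k))\<^sup>2 \<le> B" if "i \<le> n" "k \<le> n" for i k
  proof -
    have "(\<Sum>i<n. (norm (h i - gradient F w))\<^sup>2)
        = (\<Sum>i=1..n. (norm (gradient (f i) w - gradient F w))\<^sup>2)"
      using sum_permuted_index[OF p, of "\<lambda>i. (norm (gradient (f i) w - gradient F w))\<^sup>2"]
      by (simp add: h_def)
    also have "\<dots> \<le> real n * (\<Theta> * (norm (gradient F w))\<^sup>2 + \<sigma>\<^sup>2)"
      using variance[of w] n0 by (simp add: divide_le_eq mult.commute)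
    finally have var: "(\<Sum>i<n. (norm (h i - gradient F w))\<^sup>2)
        \<le> real n * (\<Theta> * (norm (gradient F w))\<^sup>2 + \<sigma>\<^sup>2)" .
    have lip: "norm (g i - h i) \<le> L * norm (W i - W 0)" if "i < n" for i
      using smooth[OF in_range[OF that]] by (simp add: g_def h_def W0)
    have "L\<^sup>2 * (norm (W i - W k))\<^sup>2 \<le> 45 / 14 * (L\<^sup>2 * \<eta>\<^sup>2) * (\<beta> * (norm (m - c))\<^sup>2
        + (\<Theta> * (norm (gradient F w))\<^sup>2 + \<sigma>\<^sup>2) + (norm (gradient F w))\<^sup>2)"
      using \<beta> by (intro epoch_drift[OF n _ _ step lip var c small that]) auto
    then show ?thesis by (simp add: B_def algebra_simps)
  qed
  have momentum: "(norm (m' - gradient F (W k)))\<^sup>2 \<le> B" if k: "k \<le> n" for k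
  proof -
    define d where "d i = g i - gradient (f (p (i + 1))) (W k)" for i
    have "gradient F (W k) = (1 / real n) *\<^sub>R (\<Sum>i<n. gradient (f (p (i + 1))) (W k))"
      using sum_permuted_index[OF p, of "\<lambda>i. gradient (f i) (W k)"]
      by (simp add: gradient_average)
    then have "m' - gradient F (W k) = (1 / real n) *\<^sub>R (\<Sum>i<n. d i)"
      by (simp add: m' d_def sum_subtractf scaleR_diff_right)
    moreover have "(norm (d i))\<^sup>2 \<le> B" if i: "i < n" for i
    proof -
      have "(norm (d i))\<^sup>2 \<le> (L * norm (W i - W k))\<^sup>2"
        unfolding d_def g_def by (intro power_mono smooth in_range i) auto
      also have "\<dots> \<le> B"
        using drift[of i k] i k by (simp add: power_mult_distrib)
      finally show ?thesis .
    qed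
    ultimately show ?thesis
      using norm_average_squared_le[OF n, of d B] by simp
  qed
  show "(norm (m' - gradient F w))\<^sup>2 \<le> B" "(norm (m' - gradient F w'))\<^sup>2 \<le> B"
    using momentum[of 0] momentum[of n] by (simp_all add: W0 Wn)
qed

lemma step_length_le:
  assumes "0 \<le> \<eta>" "L\<^sup>2 * \<eta>\<^sup>2 \<le> 1 / 45"
  shows "L * \<eta> \<le> 1"
proof -
  have "(L * \<eta>)\<^sup>2 \<le> 1\<^sup>2"
    using assms by (simp add: power_mult_distrib)
  then show ?thesis
    by (rule power2_le_imp_le) simp
qed

text \<open>With zero momentum, \<open>epoch_step_and_momentum\<close> with \<open>c = 0\<close> has no error inherited from an
  earlier epoch. The price is the shorter step length \<open>(1 - \<beta>) \<eta>\<close>, hence the factor \<open>1 - \<beta>\<close> on the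
  left.\<close>

lemma first_epoch_descent:
  assumes p: "p permutes {1..n}" and \<eta>: "0 \<le> \<eta>"
    and small: "L\<^sup>2 * \<eta>\<^sup>2 \<le> 1 / 45" "L\<^sup>2 * \<eta>\<^sup>2 * (\<Theta> + 1) \<le> (1 - \<beta>) / 18"
    and epoch: "smg_inner f n \<beta> \<eta> p w 0 n = (w', m')"
  shows "F w' + 3 / 5 * \<eta> * \<beta> * (norm (m' - gradient F w'))\<^sup>2
      + (1 - \<beta>) / 4 * (\<eta> * (norm (gradient F w))\<^sup>2) \<le> F w + 2 * L\<^sup>2 * \<sigma>\<^sup>2 * \<eta> ^ 3"
proof -
  define x G a b where "x = L\<^sup>2 * \<eta>\<^sup>2" and "G = (norm (gradient F w))\<^sup>2"
    and "a = (norm (m' - gradient F w))\<^sup>2" and "b = (norm (m' - gradient F w'))\<^sup>2"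
  have pos: "0 \<le> x" "0 \<le> G" by (simp_all add: x_def G_def)
  define Q where "Q = 45 / 14 * x * ((\<Theta> + 1) * G + \<sigma>\<^sup>2)"
  have w': "w' = w - ((1 - \<beta>) * \<eta>) *\<^sub>R m'" and a: "a \<le> Q" and b: "b \<le> Q"
    using epoch_step_and_momentum[OF p small(1) _ epoch, of 0]
    by (simp_all add: a_def b_def Q_def G_def x_def mult.commute)
  have "L * ((1 - \<beta>) * \<eta>) \<le> 1 * (L * \<eta>)"
    using \<beta> \<eta> L by (auto simp: mult_le_cancel_right1 algebra_simps)
  then have "L * ((1 - \<beta>) * \<eta>) \<le> 1"
    using step_length_le[OF \<eta> small(1)] by simp
  then have "F w' \<le> F w - (1 - \<beta>) * \<eta> / 2 * G + (1 - \<beta>) * \<eta> / 2 * a"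
    unfolding w' G_def a_def using \<beta> \<eta>
    by (intro inexact_gradient_step[OF gderiv_F gradient_F_lipschitz]) auto
  moreover have "(1 - \<beta>) * \<eta> / 2 * a \<le> 3 / 5 * ((1 - \<beta>) * \<eta>) * Q"
    using \<beta> \<eta> by (intro mult_mono a) (auto simp: a_def)
  moreover have "3 / 5 * \<eta> * \<beta> * b \<le> 3 / 5 * \<eta> * \<beta> * Q"
    using \<beta> \<eta> by (intro mult_left_mono b) auto
  moreover have "3 / 5 * ((1 - \<beta>) * \<eta>) * Q + 3 / 5 * \<eta> * \<beta> * Q
      = 27 / 14 * (\<eta> * G * (x * (\<Theta> + 1))) + 27 / 14 * (\<eta> * x * \<sigma>\<^sup>2)"
    by (simp add: Q_def field_simps)
  moreover have "\<eta> * G * (x * (\<Theta> + 1)) \<le> \<eta> * G * ((1 - \<beta>) / 18)"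
    using small(2) \<eta> pos by (intro mult_left_mono) (auto simp: x_def)
  moreover have "0 \<le> \<eta> * x * \<sigma>\<^sup>2" "0 \<le> (1 - \<beta>) * (\<eta> * G)"
    using \<eta> \<beta> pos by auto
  ultimately have "F w' + 3 / 5 * \<eta> * \<beta> * b + (1 - \<beta>) / 4 * (\<eta> * G)
      \<le> F w + 2 * (\<eta> * x * \<sigma>\<^sup>2)"
    by (simp add: algebra_simps add_divide_distrib diff_divide_distrib)
  moreover have "\<eta> * x * \<sigma>\<^sup>2 = L\<^sup>2 * \<sigma>\<^sup>2 * \<eta> ^ 3"
    by (simp add: x_def power2_eq_square power3_eq_cube)
  ultimately show ?thesis by (simp add: b_def G_def)
qed

text \<open>The coefficient \<open>3/5\<close> of the potential is large enough: the inherited momentum error enters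
  with the factor \<open>\<eta> \<beta> / 2\<close> from the descent inequality, plus at most \<open>27/14 \<cdot> 1/45 = 3/70\<close> times
  \<open>\<eta> \<beta>\<close> through the new momentum, and \<open>1/2 + 3/70 \<le> 3/5\<close>. Here \<open>\<eta>'\<close> is the learning rate of the
  preceding epoch.\<close>

lemma epoch_descent:
  assumes p: "p permutes {1..n}" and \<eta>: "0 \<le> \<eta>" "\<eta> \<le> \<eta>'"
    and small: "L\<^sup>2 * \<eta>\<^sup>2 \<le> 1 / 45" "L\<^sup>2 * \<eta>\<^sup>2 * (\<Theta> + 1) \<le> (1 - \<beta>) / 18"
    and epoch: "smg_inner f n \<beta> \<eta> p w m n = (w', m')"
  shows "F w' + 3 / 5 * \<eta> * \<beta> * (norm (m' - gradient F w'))\<^sup>2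
      + (1 - \<beta>) / 4 * (\<eta> * (norm (gradient F w))\<^sup>2)
    \<le> F w + 3 / 5 * \<eta>' * \<beta> * (norm (m - gradient F w))\<^sup>2 + 2 * L\<^sup>2 * \<sigma>\<^sup>2 * \<eta> ^ 3"
proof -
  define x G a b \<delta> where "x = L\<^sup>2 * \<eta>\<^sup>2" and "G = (norm (gradient F w))\<^sup>2"
    and "a = (norm (m' - gradient F w))\<^sup>2" and "b = (norm (m' - gradient F w'))\<^sup>2"
    and "\<delta> = (norm (m - gradient F w))\<^sup>2"
  have pos: "0 \<le> x" "0 \<le> G" "0 \<le> \<delta>" by (simp_all add: x_def G_def \<delta>_def)
  define d where "d = \<beta> *\<^sub>R m + (1 - \<beta>) *\<^sub>R m'"
  define Q where "Q = 45 / 14 * x * (\<beta> * \<delta> + ((\<Theta> + 1) * G + \<sigma>\<^sup>2))"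
  have w': "w' = w - \<eta> *\<^sub>R d" and a: "a \<le> Q" and b: "b \<le> Q"
    using epoch_step_and_momentum[OF p small(1) order_refl epoch]
    by (simp_all add: a_def b_def Q_def G_def x_def \<delta>_def d_def)
  have "F w' \<le> F w - \<eta> / 2 * G + \<eta> / 2 * (norm (d - gradient F w))\<^sup>2"
    unfolding w' G_def using step_length_le[OF \<eta>(1) small(1)] \<eta>
    by (intro inexact_gradient_step[OF gderiv_F gradient_F_lipschitz]) auto
  moreover have "\<eta> / 2 * (norm (d - gradient F w))\<^sup>2 \<le> \<eta> / 2 * (\<beta> * \<delta> + (1 - \<beta>) * a)"
  proof -
    have "d - gradient F w = \<beta> *\<^sub>R (m - gradient F w) + (1 - \<beta>) *\<^sub>R (m' - gradient F w)"
      by (simp add: d_def algebra_simps)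
    then show ?thesis
      using norm_convex_squared_le[of \<beta> "m - gradient F w" "m' - gradient F w"] \<beta> \<eta>
      by (intro mult_left_mono) (auto simp: \<delta>_def a_def)
  qed
  moreover have "(1 - \<beta>) * \<eta> / 2 * a \<le> 3 / 5 * ((1 - \<beta>) * \<eta>) * Q"
    using \<beta> \<eta> by (intro mult_mono a) (auto simp: a_def)
  moreover have "3 / 5 * \<eta> * \<beta> * b \<le> 3 / 5 * \<eta> * \<beta> * Q"
    using \<beta> \<eta> by (intro mult_left_mono b) auto
  moreover have "3 / 5 * ((1 - \<beta>) * \<eta>) * Q + 3 / 5 * \<eta> * \<beta> * Q
      = 27 / 14 * (x * (\<eta> * \<beta> * \<delta>)) + 27 / 14 * (\<eta> * G * (x * (\<Theta> + 1)))
        + 27 / 14 * (\<eta> * x * \<sigma>\<^sup>2)"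
    by (simp add: Q_def field_simps)
  moreover have "x * (\<eta> * \<beta> * \<delta>) \<le> 1 / 45 * (\<eta> * \<beta> * \<delta>)"
    using small(1) \<eta> \<beta> pos by (intro mult_right_mono) (auto simp: x_def)
  moreover have "\<eta> * \<beta> * \<delta> \<le> \<eta>' * \<beta> * \<delta>"
    using \<eta> \<beta> pos by (intro mult_right_mono) auto
  moreover have "\<eta> * G * (x * (\<Theta> + 1)) \<le> \<eta> * G * (1 / 18)"
    using small(2) \<eta> \<beta> pos by (intro mult_left_mono) (auto simp: x_def)
  moreover have "0 \<le> \<eta> * x * \<sigma>\<^sup>2" "0 \<le> \<eta> * G" "0 \<le> \<eta> * \<beta> * \<delta>" "0 \<le> \<beta> * (\<eta> * G)"
    using \<eta> \<beta> pos by auto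
  ultimately have "F w' + 3 / 5 * \<eta> * \<beta> * b + (1 - \<beta>) / 4 * (\<eta> * G)
      \<le> F w + 3 / 5 * (\<eta>' * \<beta> * \<delta>) + 2 * (\<eta> * x * \<sigma>\<^sup>2)"
    by (simp add: algebra_simps add_divide_distrib diff_divide_distrib)
  moreover have "\<eta> * x * \<sigma>\<^sup>2 = L\<^sup>2 * \<sigma>\<^sup>2 * \<eta> ^ 3"
    by (simp add: x_def power2_eq_square power3_eq_cube)
  ultimately show ?thesis by (simp add: b_def G_def \<delta>_def)
qed

text \<open>The inequality holds along every sequence of permutations; no randomness is involved.\<close>

lemma smg_gradient_sum_le:
  fixes \<eta> :: "nat \<Rightarrow> real"
  assumes p: "\<And>t. t \<in> {1..T} \<Longrightarrow> p t permutes {1..n}"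
    and \<eta>_nonneg: "\<And>t. t \<ge> 1 \<Longrightarrow> 0 \<le> \<eta> t"
    and \<eta>_antimono: "\<And>s t. 1 \<le> s \<Longrightarrow> s \<le> t \<Longrightarrow> \<eta> t \<le> \<eta> s"
    and small: "L\<^sup>2 * (\<eta> 1)\<^sup>2 \<le> 1 / 45" "L\<^sup>2 * (\<eta> 1)\<^sup>2 * (\<Theta> + 1) \<le> (1 - \<beta>) / 18"
    and lower: "\<And>w. Fstar \<le> F w" and T: "T \<ge> 1"
  shows "(1 - \<beta>) / 4 * (\<Sum>t=1..T. \<eta> t * (norm (gradient F (fst (smg f n \<beta> \<eta> p w0 (t - 1)))))\<^sup>2)
    \<le> F w0 - Fstar + 2 * L\<^sup>2 * \<sigma>\<^sup>2 * (\<Sum>t=1..T. \<eta> t ^ 3)"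
proof -
  define W m where "W t = fst (smg f n \<beta> \<eta> p w0 t)"
    and "m t = snd (smg f n \<beta> \<eta> p w0 t)" for t
  have epoch: "smg_inner f n \<beta> (\<eta> (Suc t)) (p (Suc t)) (W t) (m t) n = (W (Suc t), m (Suc t))"
    for t by (simp add: W_def m_def case_prod_beta Let_def)
  have small_t: "L\<^sup>2 * (\<eta> t)\<^sup>2 \<le> 1 / 45" "L\<^sup>2 * (\<eta> t)\<^sup>2 * (\<Theta> + 1) \<le> (1 - \<beta>) / 18"
    if "t \<ge> 1" for t
  proof -
    have *: "L\<^sup>2 * (\<eta> t)\<^sup>2 \<le> L\<^sup>2 * (\<eta> 1)\<^sup>2"
      using \<eta>_antimono[of 1 t] \<eta>_nonneg[of t] that by (intro mult_left_mono power_mono) auto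
    then show "L\<^sup>2 * (\<eta> t)\<^sup>2 \<le> 1 / 45"
      using small(1) by linarith
    show "L\<^sup>2 * (\<eta> t)\<^sup>2 * (\<Theta> + 1) \<le> (1 - \<beta>) / 18"
      using mult_right_mono[OF *, of "\<Theta> + 1"] \<Theta> small(2) by linarith
  qed
  have "F (W t) + 3 / 5 * \<eta> t * \<beta> * (norm (m t - gradient F (W t)))\<^sup>2
      + (1 - \<beta>) / 4 * (\<Sum>s=1..t. \<eta> s * (norm (gradient F (W (s - 1))))\<^sup>2)
      \<le> F w0 + 2 * L\<^sup>2 * \<sigma>\<^sup>2 * (\<Sum>s=1..t. \<eta> s ^ 3)" if "1 \<le> t" "t \<le> T" for t
    using that
  proof (induction t rule: dec_induct)
    case base
    have "W 0 = w0" "m 0 = 0" by (simp_all add: W_def m_def)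
    then show ?case
      using first_epoch_descent[of "p 1" "\<eta> 1" w0 "W 1" "m 1", OF p \<eta>_nonneg small_t] epoch[of 0] T
      by simp
  next
    case (step t)
    have "F (W (Suc t)) + 3 / 5 * \<eta> (Suc t) * \<beta> * (norm (m (Suc t) - gradient F (W (Suc t))))\<^sup>2
        + (1 - \<beta>) / 4 * (\<eta> (Suc t) * (norm (gradient F (W t)))\<^sup>2)
      \<le> F (W t) + 3 / 5 * \<eta> t * \<beta> * (norm (m t - gradient F (W t)))\<^sup>2
        + 2 * L\<^sup>2 * \<sigma>\<^sup>2 * \<eta> (Suc t) ^ 3"
      using step by (intro epoch_descent[OF p \<eta>_nonneg \<eta>_antimono small_t epoch]) auto
    with step show ?case by (simp add: algebra_simps)
  qed
  from this[of T] have "F (W T) + 3 / 5 * \<eta> T * \<beta> * (norm (m T - gradient F (W T)))\<^sup>2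
      + (1 - \<beta>) / 4 * (\<Sum>s=1..T. \<eta> s * (norm (gradient F (W (s - 1))))\<^sup>2)
      \<le> F w0 + 2 * L\<^sup>2 * \<sigma>\<^sup>2 * (\<Sum>s=1..T. \<eta> s ^ 3)"
    using T by simp
  moreover have "0 \<le> 3 / 5 * \<eta> T * \<beta> * (norm (m T - gradient F (W T)))\<^sup>2"
    using \<eta>_nonneg[OF T] \<beta> by simp
  ultimately show ?thesis
    using lower[of "W T"] unfolding W_def by linarith
qed

end

section \<open>Averaging over the random output index\<close>

lemma smg_cong:
  assumes "\<And>t. t \<in> {1..k} \<Longrightarrow> p t = q t"
  shows "smg f n \<beta> \<eta> p w0 k = smg f n \<beta> \<eta> q w0 k"
  using assms
proof (induction k)
  case (Suc k)
  then show ?case by simp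
qed simp

text \<open>A bound on the \<open>\<eta>\<close>-weighted mean that holds for all permutation sequences passes to the
  expectation at the random index. There are only finitely many sequences on \<open>{1..T}\<close>, so the
  expectation is a finite sum over the pairs of an index \<open>t\<close> and a sequence \<open>q\<close>, and independence
  factors the probability of each pair.\<close>

lemma expectation_random_index_le:
  fixes \<phi> :: "nat \<Rightarrow> (nat \<Rightarrow> nat \<Rightarrow> nat) \<Rightarrow> real"
  assumes rand: "smg_randomness n \<eta> T M \<pi> \<tau>"
    and local: "\<And>t p q. t \<in> {1..T} \<Longrightarrow> (\<And>s. s \<in> {1..T} \<Longrightarrow> p s = q s) \<Longrightarrow> \<phi> t p = \<phi> t q"
    and bound: "\<And>p. (\<And>t. t \<in> {1..T} \<Longrightarrow> p t permutes {1..n}) \<Longrightarrow>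
      (\<Sum>t=1..T. \<eta> t * \<phi> t p) / (\<Sum>t=1..T. \<eta> t) \<le> B"
  shows "prob_space.expectation M (\<lambda>\<omega>. \<phi> (\<tau> \<omega>) (\<lambda>t. \<pi> t \<omega>)) \<le> B"
proof -
  interpret prob_space M using rand unfolding smg_randomness_def by blast
  define S where "S = {p. p permutes {1..n}}"
  define Q where "Q = PiE {1..T} (\<lambda>_. S)"
  define X where "X = (\<lambda>\<omega>. \<lambda>t\<in>{1..T}. \<pi> t \<omega>)"
  define P where "P = PiM {1..T} (\<lambda>_. count_space S)"
  \<comment> \<open>\<open>A t\<close> is the event that the index is \<open>t\<close>, and \<open>C q\<close> that the permutations are \<open>q\<close>.\<close>
  define A where "A t = \<tau> -` {t} \<inter> space M" for t
  define C where "C q = X -` {q} \<inter> space M" for q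
  have \<pi>: "\<pi> t \<in> M \<rightarrow>\<^sub>M count_space S" if "t \<in> {1..T}" for t
    using rand that unfolding smg_randomness_def S_def by blast
  have \<tau>: "\<tau> \<in> M \<rightarrow>\<^sub>M count_space {1..T}"
    using rand unfolding smg_randomness_def by blast
  have prob_\<tau>: "prob (A t) = \<eta> t / (\<Sum>s=1..T. \<eta> s)" if "t \<in> {1..T}" for t
  proof -
    have "A t = {\<omega> \<in> space M. \<tau> \<omega> = t}" by (auto simp: A_def)
    then show ?thesis using rand that unfolding smg_randomness_def by simp
  qed
  have X: "X \<in> M \<rightarrow>\<^sub>M P"
    unfolding X_def P_def by (intro measurable_restrict \<pi>)
  have fin: "finite S" "finite Q"
    unfolding S_def Q_def by (auto intro!: finite_permutations finite_PiE)
  have X_in: "X \<omega> \<in> Q" if "\<omega> \<in> space M" for \<omega>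
    using measurable_space[OF X that] by (simp add: P_def Q_def space_PiM)
  have \<tau>_in: "\<tau> \<omega> \<in> {1..T}" if "\<omega> \<in> space M" for \<omega>
    using measurable_space[OF \<tau> that] by simp
  have singleton: "{q} \<in> sets P" if "q \<in> Q" for q
  proof -
    have "{q} = PiE {1..T} (\<lambda>t. {q t})"
      using that PiE_singleton[of q "{1..T}"] by (simp add: Q_def PiE_iff)
    also have "\<dots> \<in> sets P"
      unfolding P_def using that by (intro sets_PiM_I_finite) (auto simp: Q_def PiE_mem)
    finally show ?thesis .
  qed
  have ind: "prob (A t \<inter> C q) = prob (A t) * prob (C q)" if "t \<in> {1..T}" "q \<in> Q" for t q
  proof (rule indep_setD)
    show "indep_set (sets (vimage_algebra (space M) \<tau> (count_space {1..T})))
        (sets (vimage_algebra (space M) X P))"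
      using rand unfolding smg_randomness_def X_def P_def S_def by blast
    show "A t \<in> sets (vimage_algebra (space M) \<tau> (count_space {1..T}))"
      unfolding A_def using that by (intro in_vimage_algebra) auto
    show "C q \<in> sets (vimage_algebra (space M) X P)"
      unfolding C_def using that by (intro in_vimage_algebra singleton)
  qed
  have A: "A t \<in> events" if "t \<in> {1..T}" for t
    unfolding A_def using that by (intro measurable_sets[OF \<tau>]) auto
  have C: "C q \<in> events" if "q \<in> Q" for q
    unfolding C_def using that by (intro measurable_sets[OF X] singleton)
  have "(\<Sum>q\<in>Q. prob (C q)) = prob (\<Union>q\<in>Q. C q)"
    using fin C by (intro finite_measure_finite_Union[symmetric])
      (auto simp: disjoint_family_on_def C_def)
  also have "(\<Union>q\<in>Q. C q) = space M"
    using X_in by (auto simp: C_def)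
  finally have total: "(\<Sum>q\<in>Q. prob (C q)) = 1"
    by (simp add: prob_space)
  have decomp: "\<phi> (\<tau> \<omega>) (\<lambda>t. \<pi> t \<omega>) = (\<Sum>q\<in>Q. \<Sum>t=1..T. indicator (A t \<inter> C q) \<omega> * \<phi> t q)"
    if \<omega>: "\<omega> \<in> space M" for \<omega>
  proof -
    have "(\<Sum>q\<in>Q. \<Sum>t=1..T. indicator (A t \<inter> C q) \<omega> * \<phi> t q)
        = (\<Sum>q\<in>Q. if X \<omega> = q then \<Sum>t=1..T. if \<tau> \<omega> = t then \<phi> t q else 0 else 0)"
      using \<omega> by (intro sum.cong refl) (auto simp: A_def C_def indicator_def intro!: sum.cong)
    also have "\<dots> = \<phi> (\<tau> \<omega>) (X \<omega>)"
      using fin X_in[OF \<omega>] \<tau>_in[OF \<omega>] by simp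
    also have "\<dots> = \<phi> (\<tau> \<omega>) (\<lambda>t. \<pi> t \<omega>)"
      using \<tau>_in[OF \<omega>] by (intro local) (auto simp: X_def)
    finally show ?thesis by simp
  qed
  have "expectation (\<lambda>\<omega>. \<phi> (\<tau> \<omega>) (\<lambda>t. \<pi> t \<omega>))
      = expectation (\<lambda>\<omega>. \<Sum>q\<in>Q. \<Sum>t=1..T. indicator (A t \<inter> C q) \<omega> * \<phi> t q)"
    by (intro Bochner_Integration.integral_cong refl decomp)
  also have "\<dots> = (\<Sum>q\<in>Q. \<Sum>t=1..T. prob (A t \<inter> C q) * \<phi> t q)"
  proof -
    have int: "integrable M (\<lambda>\<omega>. indicator (A t \<inter> C q) \<omega> * \<phi> t q)"
      "expectation (\<lambda>\<omega>. indicator (A t \<inter> C q) \<omega> * \<phi> t q) = prob (A t \<inter> C q) * \<phi> t q"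
      if "t \<in> {1..T}" "q \<in> Q" for t q
      using A[OF that(1)] C[OF that(2)] by (simp_all add: less_top[symmetric])
    have "expectation (\<lambda>\<omega>. \<Sum>q\<in>Q. \<Sum>t=1..T. indicator (A t \<inter> C q) \<omega> * \<phi> t q)
        = (\<Sum>q\<in>Q. expectation (\<lambda>\<omega>. \<Sum>t=1..T. indicator (A t \<inter> C q) \<omega> * \<phi> t q))"
      by (intro Bochner_Integration.integral_sum Bochner_Integration.integrable_sum int)
    also have "\<dots> = (\<Sum>q\<in>Q. \<Sum>t=1..T. expectation (\<lambda>\<omega>. indicator (A t \<inter> C q) \<omega> * \<phi> t q))"
      by (intro sum.cong refl Bochner_Integration.integral_sum int)
    also have "\<dots> = (\<Sum>q\<in>Q. \<Sum>t=1..T. prob (A t \<inter> C q) * \<phi> t q)"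
      by (intro sum.cong refl int)
    finally show ?thesis .
  qed
  also have "\<dots> = (\<Sum>q\<in>Q. prob (C q) * ((\<Sum>t=1..T. \<eta> t * \<phi> t q) / (\<Sum>t=1..T. \<eta> t)))"
    by (intro sum.cong refl)
       (simp add: ind prob_\<tau> sum_distrib_left sum_divide_distrib mult_ac)
  also have "\<dots> \<le> (\<Sum>q\<in>Q. prob (C q) * B)"
    by (intro sum_mono mult_left_mono bound) (auto simp: Q_def S_def PiE_mem)
  also have "\<dots> = B"
    by (simp add: total flip: sum_distrib_right)
  finally show ?thesis .
qed

section \<open>The diminishing learning rate\<close>

lemma sum_inverse_cube_root_ge:
  fixes lam :: real
  assumes "lam \<ge> 0" "T \<ge> 1"
  shows "(real T + lam) powr (2 / 3) - (1 + lam) powr (2 / 3)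
    \<le> (\<Sum>t=1..T. 1 / (real t + lam) powr (1 / 3))"
  using assms(2)
proof (induction T rule: dec_induct)
  case (step T)
  \<comment> \<open>With \<open>b \<le> a\<close> and \<open>a\<^sup>3 - b\<^sup>3 = 1\<close>, one has \<open>a (a\<^sup>2 - b\<^sup>2) \<le> a\<^sup>3 - b\<^sup>3 = 1\<close>.\<close>
  define a b where "a = (real (Suc T) + lam) powr (1 / 3)" and "b = (real T + lam) powr (1 / 3)"
  have pos: "0 < b" "b \<le> a"
    using step assms unfolding a_def b_def by (auto intro!: powr_mono2)
  have sq: "(real (Suc T) + lam) powr (2 / 3) = a\<^sup>2" "(real T + lam) powr (2 / 3) = b\<^sup>2"
    unfolding a_def b_def by (simp_all add: power2_eq_square flip: powr_add)
  have "a ^ 3 = real (Suc T) + lam" "b ^ 3 = real T + lam"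
    using step assms unfolding a_def b_def by (simp_all add: powr_power)
  then have "a ^ 3 = b ^ 3 + 1" by simp
  moreover have "b ^ 3 \<le> a * b\<^sup>2"
    using mult_right_mono[OF pos(2), of "b\<^sup>2"] by (simp add: power3_eq_cube power2_eq_square)
  ultimately have "a * (a\<^sup>2 - b\<^sup>2) \<le> 1"
    by (simp add: algebra_simps power3_eq_cube power2_eq_square)
  then have "a\<^sup>2 - b\<^sup>2 \<le> 1 / a"
    using pos by (simp add: le_divide_eq mult.commute)
  with step.IH show ?case
    unfolding sq by (simp add: a_def sq)
qed simp

text \<open>The summands for \<open>2 \<le> t \<le> T - 1\<close> are dominated by the integral of \<open>1 / (x + lam)\<close> up to
  \<open>T - 1\<close>, and the first and the last one account for \<open>2 / (1 + lam)\<close>.\<close>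

lemma sum_shifted_harmonic_le:
  fixes lam :: real
  assumes "lam \<ge> 0" "T \<ge> 2"
  shows "(\<Sum>t=1..T. 1 / (real t + lam)) \<le> 2 / (1 + lam) + ln (real T - 1 + lam)"
  using assms(2)
proof (induction T rule: dec_induct)
  case base
  have "1 / (2 + lam) \<le> 1 / (1 + lam)"
    using assms by (intro divide_left_mono) auto
  moreover have "0 \<le> ln (1 + lam)"
    using assms by simp
  moreover have "(\<Sum>t=1..2. 1 / (real t + lam)) = 1 / (1 + lam) + 1 / (2 + lam)"
    by (simp add: numeral_2_eq_2)
  ultimately show ?case by simp
next
  case (step T)
  define z where "z = real T - 1 + lam"
  have z: "z \<ge> 1" using step assms by (simp add: z_def)
  have "ln (z / (z + 1)) \<le> z / (z + 1) - 1"
    using z by (intro ln_le_minus_one) auto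
  also have "\<dots> = - 1 / (z + 1)"
    using z by (simp add: field_simps)
  finally have "1 / (z + 1) \<le> ln (z + 1) - ln z"
    using z by (simp add: ln_div)
  moreover have "1 / (real (Suc T) + lam) \<le> 1 / (z + 1)"
    using z by (intro divide_left_mono) (auto simp: z_def)
  ultimately show ?case
    using step.IH by (simp add: z_def)
qed

lemma rate_bigo:
  fixes lam C1 C2 :: real
  assumes "lam \<ge> 0"
  shows "(\<lambda>T. (C1 + C2 * ln (real T - 1 + lam)) / ((real T + lam) powr (2 / 3) - (1 + lam) powr (2 / 3)))
    \<in> O(\<lambda>T. real T powr (-2 / 3) * ln (real T))"
proof -
  define c where "c = (1 + lam) powr (2 / 3)"
  \<comment> \<open>Splitting off \<open>C1\<close> and \<open>C2\<close> avoids a case distinction on their signs.\<close>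
  have "(\<lambda>T. 1 / ((real T + lam) powr (2 / 3) - c)) \<in> O(\<lambda>T. real T powr (-2 / 3) * ln (real T))"
    by real_asymp
  moreover have "(\<lambda>T. ln (real T - 1 + lam) / ((real T + lam) powr (2 / 3) - c))
      \<in> O(\<lambda>T. real T powr (-2 / 3) * ln (real T))"
    by real_asymp
  ultimately have "(\<lambda>T. C1 * (1 / ((real T + lam) powr (2 / 3) - c))
      + C2 * (ln (real T - 1 + lam) / ((real T + lam) powr (2 / 3) - c)))
      \<in> O(\<lambda>T. 1 * (real T powr (-2 / 3) * ln (real T)))"
    by (intro sum_in_bigo landau_o.big.mult) simp_all
  then show ?thesis
    by (simp add: c_def add_divide_distrib)
qed


theorem corollary2:
  fixes f :: "nat \<Rightarrow> real ^ 'd \<Rightarrow> real"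
    and F :: "real ^ 'd \<Rightarrow> real"
    and w0 :: "real ^ 'd"
    and n :: nat
    and L \<Theta> \<sigma> \<beta> \<gamma> lam K Fstar C1 C2 :: real
    and \<eta> :: "nat \<Rightarrow> real"
  assumes n: "n \<ge> 1"
    and differentiable: "\<forall>i\<in>{1..n}. \<forall>w. f i differentiable (at w)"
    and F: "F = (\<lambda>w. (1 / real n) * (\<Sum>i=1..n. f i w))"
    and bounded_below: "bdd_below (range F)"
    and Fstar: "Fstar = (INF w. F w)"
    and L: "L > 0"
    and smooth: "\<forall>i\<in>{1..n}. \<forall>w w'.
      norm (gradient (f i) w - gradient (f i) w') \<le> L * norm (w - w')"
    and variance_constants: "\<Theta> \<ge> 0" "\<sigma> \<ge> 0"
    and variance: "\<forall>w. (1 / real n) * (\<Sum>i=1..n. (norm (gradient (f i) w - gradient F w))\<^sup>2)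
      \<le> \<Theta> * (norm (gradient F w))\<^sup>2 + \<sigma>\<^sup>2"
    and \<beta>: "0 \<le> \<beta>" "\<beta> < 1"
    and K: "K = max (5 / 2) (9 * (5 - 3 * \<beta>) * (\<Theta> + 1) / (1 - \<beta>))"
    and \<gamma>: "\<gamma> > 0"
    and lam: "lam \<ge> 0"
    and \<eta>: "\<eta> = (\<lambda>t. \<gamma> / (real t + lam) powr (1 / 3))"
    and \<eta>1: "\<eta> 1 \<le> 1 / (L * sqrt K)"
    and C1: "C1 = 4 * (F w0 - Fstar) / ((1 - \<beta>) * \<gamma>)
      + 18 * \<sigma>\<^sup>2 * L\<^sup>2 * (5 - 3 * \<beta>) * \<gamma>\<^sup>2 / ((1 - \<beta>) * (1 + lam))"
    and C2: "C2 = 9 * \<sigma>\<^sup>2 * L\<^sup>2 * (5 - 3 * \<beta>) * \<gamma>\<^sup>2 / (1 - \<beta>)"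
  shows "(\<forall>T (M :: 'w measure) \<pi> \<tau>. T \<ge> 2 \<longrightarrow> smg_randomness n \<eta> T M \<pi> \<tau> \<longrightarrow>
            prob_space.expectation M (\<lambda>\<omega>. (norm (gradient F (smg_output f n \<beta> \<eta> w0 \<pi> \<tau> \<omega>)))\<^sup>2)
            \<le> (C1 + C2 * ln (real T - 1 + lam)) / ((real T + lam) powr (2 / 3) - (1 + lam) powr (2 / 3)))
       \<and> (\<forall>(M :: nat \<Rightarrow> 'w measure) \<pi> \<tau>. (\<forall>T\<ge>2. smg_randomness n \<eta> T (M T) (\<pi> T) (\<tau> T)) \<longrightarrow>
            (\<lambda>T. prob_space.expectation (M T)
                   (\<lambda>\<omega>. (norm (gradient F (smg_output f n \<beta> \<eta> w0 (\<pi> T) (\<tau> T) \<omega>)))\<^sup>2))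
            \<in> O(\<lambda>T. real T powr (-2 / 3) * ln (real T)))"
proof -
  interpret smooth_finite_sum f F n L \<Theta> \<sigma> \<beta>
    using n differentiable F L smooth variance_constants variance \<beta>
    by unfold_locales auto
  have \<beta>_bounds: "2 \<le> 5 - 3 * \<beta>" "0 < 1 - \<beta>" using \<beta> by auto
  have \<eta>_pos: "0 < \<eta> t" if "t \<ge> 1" for t
    using that lam \<gamma> by (simp add: \<eta>)
  have \<eta>_antimono: "\<eta> t \<le> \<eta> s" if "1 \<le> s" "s \<le> t" for s t
    unfolding \<eta> using that lam \<gamma> by (intro divide_left_mono powr_mono2 mult_pos_pos) auto
  have \<eta>_cube: "\<eta> t ^ 3 = \<gamma> ^ 3 / (real t + lam)" if "t \<ge> 1" for t
    using that lam by (simp add: \<eta> power_divide powr_power)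
  \<comment> \<open>\<open>N\<close> is the second argument of the maximum \<open>K\<close>. It always is at least \<open>45\<close>, so the first
    one never matters.\<close>
  define N where "N = 9 * (5 - 3 * \<beta>) * (\<Theta> + 1) / (1 - \<beta>)"
  have N: "N \<ge> 45 * (\<Theta> + 1)" "N \<ge> 18 * (\<Theta> + 1) / (1 - \<beta>)"
  proof -
    have "45 * (1 - \<beta>) \<le> 9 * (5 - 3 * \<beta>)" using \<beta> by simp
    from mult_right_mono[OF this, of "\<Theta> + 1"] show "N \<ge> 45 * (\<Theta> + 1)"
      using \<beta>_bounds variance_constants by (simp add: N_def le_divide_eq algebra_simps)
    have "18 \<le> 9 * (5 - 3 * \<beta>)" using \<beta> by simp
    from mult_right_mono[OF this, of "\<Theta> + 1"] show "N \<ge> 18 * (\<Theta> + 1) / (1 - \<beta>)"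
      unfolding N_def using \<beta>_bounds variance_constants by (intro divide_right_mono) auto
  qed
  have xN: "L\<^sup>2 * (\<eta> 1)\<^sup>2 * N \<le> 1"
  proof -
    have K_pos: "K > 0" and NK: "N \<le> K" by (simp_all add: K N_def)
    have "L * sqrt K * \<eta> 1 \<le> 1"
      using \<eta>1 L K_pos by (simp add: le_divide_eq mult_ac)
    then have "(L * sqrt K * \<eta> 1)\<^sup>2 \<le> 1\<^sup>2"
      using L K_pos \<eta>_pos[of 1] by (intro power_mono) auto
    then have "L\<^sup>2 * (\<eta> 1)\<^sup>2 * K \<le> 1"
      using K_pos by (simp add: power_mult_distrib mult_ac)
    moreover have "L\<^sup>2 * (\<eta> 1)\<^sup>2 * N \<le> L\<^sup>2 * (\<eta> 1)\<^sup>2 * K"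
      using NK by (intro mult_left_mono) auto
    ultimately show ?thesis by linarith
  qed
  have small: "L\<^sup>2 * (\<eta> 1)\<^sup>2 \<le> 1 / 45" "L\<^sup>2 * (\<eta> 1)\<^sup>2 * (\<Theta> + 1) \<le> (1 - \<beta>) / 18"
  proof -
    have "45 \<le> N" using N(1) variance_constants by argo
    then have "L\<^sup>2 * (\<eta> 1)\<^sup>2 * 45 \<le> L\<^sup>2 * (\<eta> 1)\<^sup>2 * N" by (intro mult_left_mono) auto
    with xN show "L\<^sup>2 * (\<eta> 1)\<^sup>2 \<le> 1 / 45" by linarith
    have "L\<^sup>2 * (\<eta> 1)\<^sup>2 * (18 * (\<Theta> + 1) / (1 - \<beta>)) \<le> L\<^sup>2 * (\<eta> 1)\<^sup>2 * N"
      by (intro mult_left_mono N) auto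
    with xN have "L\<^sup>2 * (\<eta> 1)\<^sup>2 * (18 * (\<Theta> + 1) / (1 - \<beta>)) \<le> 1" by linarith
    then show "L\<^sup>2 * (\<eta> 1)\<^sup>2 * (\<Theta> + 1) \<le> (1 - \<beta>) / 18"
      using \<beta>_bounds by (simp add: divide_le_eq algebra_simps)
  qed
  have lower: "Fstar \<le> F w" for w
    unfolding Fstar using bounded_below by (intro cINF_lower) auto
  have path_bound: "(\<Sum>t=1..T. \<eta> t * (norm (gradient F (fst (smg f n \<beta> \<eta> p w0 (t - 1)))))\<^sup>2)
      / (\<Sum>t=1..T. \<eta> t)
    \<le> (C1 + C2 * ln (real T - 1 + lam)) / ((real T + lam) powr (2 / 3) - (1 + lam) powr (2 / 3))"
    if T: "T \<ge> 2" and p: "\<And>t. t \<in> {1..T} \<Longrightarrow> p t permutes {1..n}" for T p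
  proof -
    define D where "D = (real T + lam) powr (2 / 3) - (1 + lam) powr (2 / 3)"
    define \<Delta> where "\<Delta> = F w0 - Fstar"
    define H where "H = 2 / (1 + lam) + ln (real T - 1 + lam)"
    define S where "S = (\<Sum>t=1..T. \<eta> t * (norm (gradient F (fst (smg f n \<beta> \<eta> p w0 (t - 1)))))\<^sup>2)"
    have D: "D > 0"
      unfolding D_def using T lam by (simp add: powr_less_mono2)
    have "\<Delta> \<ge> 0" using lower[of w0] by (simp add: \<Delta>_def)
    have "H \<ge> 0" using T lam by (simp add: H_def)
    have "(\<Sum>t=1..T. \<eta> t ^ 3) = \<gamma> ^ 3 * (\<Sum>t=1..T. 1 / (real t + lam))"
      by (simp add: \<eta>_cube sum_distrib_left)
    also have "\<dots> \<le> \<gamma> ^ 3 * H"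
      unfolding H_def using \<gamma> by (intro mult_left_mono sum_shifted_harmonic_le lam T) auto
    finally have cubes: "(\<Sum>t=1..T. \<eta> t ^ 3) \<le> \<gamma> ^ 3 * H" .
    have "\<gamma> * D \<le> \<gamma> * (\<Sum>t=1..T. 1 / (real t + lam) powr (1 / 3))"
      unfolding D_def using \<gamma> T by (intro mult_left_mono sum_inverse_cube_root_ge lam) auto
    also have "\<dots> = (\<Sum>t=1..T. \<eta> t)"
      by (simp add: \<eta> sum_distrib_left)
    finally have rates: "\<gamma> * D \<le> (\<Sum>t=1..T. \<eta> t)" .
    have "(1 - \<beta>) / 4 * S \<le> \<Delta> + 2 * L\<^sup>2 * \<sigma>\<^sup>2 * (\<Sum>t=1..T. \<eta> t ^ 3)"
      unfolding S_def \<Delta>_def using \<eta>_pos T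
      by (intro smg_gradient_sum_le p \<eta>_antimono small lower) (auto simp: less_imp_le)
    also have "\<dots> \<le> \<Delta> + 2 * L\<^sup>2 * \<sigma>\<^sup>2 * (\<gamma> ^ 3 * H)"
      by (intro add_left_mono mult_left_mono cubes) auto
    finally have "S \<le> (4 * \<Delta> + 8 * (L\<^sup>2 * \<sigma>\<^sup>2 * \<gamma> ^ 3 * H)) / (1 - \<beta>)"
      using \<beta>_bounds by (simp add: field_simps)
    \<comment> \<open>Coarsening \<open>8 \<le> 9 (5 - 3 \<beta>)\<close> gives the stated constants.\<close>
    also have "\<dots> \<le> (4 * \<Delta> + 9 * (5 - 3 * \<beta>) * (L\<^sup>2 * \<sigma>\<^sup>2 * \<gamma> ^ 3 * H)) / (1 - \<beta>)"
      using \<beta>_bounds \<gamma> \<open>H \<ge> 0\<close> by (intro divide_right_mono add_left_mono mult_right_mono) auto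
    also have "\<dots> = \<gamma> * (C1 + C2 * ln (real T - 1 + lam))"
      using \<gamma> \<beta>_bounds lam unfolding C1 C2 H_def \<Delta>_def
      by (simp add: divide_simps) (simp add: algebra_simps power2_eq_square power3_eq_cube)
    finally have S: "S \<le> \<gamma> * (C1 + C2 * ln (real T - 1 + lam))" .
    have "0 \<le> S"
      unfolding S_def using \<eta>_pos by (intro sum_nonneg mult_nonneg_nonneg) (auto simp: less_imp_le)
    then have "S / (\<Sum>t=1..T. \<eta> t) \<le> S / (\<gamma> * D)"
      using rates \<gamma> D by (intro divide_left_mono mult_pos_pos) (auto intro: less_le_trans[OF mult_pos_pos])
    also have "\<dots> \<le> \<gamma> * (C1 + C2 * ln (real T - 1 + lam)) / (\<gamma> * D)"
      using S \<gamma> D by (intro divide_right_mono) auto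
    also have "\<dots> = (C1 + C2 * ln (real T - 1 + lam)) / D"
      using \<gamma> by simp
    finally show ?thesis by (simp add: S_def D_def)
  qed
  have bound: "prob_space.expectation M (\<lambda>\<omega>. (norm (gradient F (smg_output f n \<beta> \<eta> w0 \<pi> \<tau> \<omega>)))\<^sup>2)
      \<le> (C1 + C2 * ln (real T - 1 + lam)) / ((real T + lam) powr (2 / 3) - (1 + lam) powr (2 / 3))"
    if T: "T \<ge> 2" and rand: "smg_randomness n \<eta> T M \<pi> \<tau>" for T \<pi> \<tau> and M :: "'w measure"
    unfolding smg_output_def
  proof (rule expectation_random_index_le[OF rand, where
      \<phi> = "\<lambda>t p. (norm (gradient F (fst (smg f n \<beta> \<eta> p w0 (t - 1)))))\<^sup>2"])
    fix t and p q :: "nat \<Rightarrow> nat \<Rightarrow> nat"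
    assume "t \<in> {1..T}" "\<And>s. s \<in> {1..T} \<Longrightarrow> p s = q s"
    then have "smg f n \<beta> \<eta> p w0 (t - 1) = smg f n \<beta> \<eta> q w0 (t - 1)"
      by (intro smg_cong) auto
    then show "(norm (gradient F (fst (smg f n \<beta> \<eta> p w0 (t - 1)))))\<^sup>2
        = (norm (gradient F (fst (smg f n \<beta> \<eta> q w0 (t - 1)))))\<^sup>2" by simp
  qed (rule path_bound[OF T])
  show ?thesis
  proof (intro conjI allI impI)
    fix M :: "nat \<Rightarrow> 'w measure" and \<pi> \<tau>
    assume rand: "\<forall>T\<ge>2. smg_randomness n \<eta> T (M T) (\<pi> T) (\<tau> T)"
    have "(\<lambda>T. prob_space.expectation (M T)
          (\<lambda>\<omega>. (norm (gradient F (smg_output f n \<beta> \<eta> w0 (\<pi> T) (\<tau> T) \<omega>)))\<^sup>2))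
        \<in> O(\<lambda>T. (C1 + C2 * ln (real T - 1 + lam))
          / ((real T + lam) powr (2 / 3) - (1 + lam) powr (2 / 3)))"
    proof (intro bigoI[where c = 1] eventually_mono[OF eventually_ge_at_top[of 2]])
      fix T :: nat assume T: "T \<ge> 2"
      have "0 \<le> prob_space.expectation (M T)
          (\<lambda>\<omega>. (norm (gradient F (smg_output f n \<beta> \<eta> w0 (\<pi> T) (\<tau> T) \<omega>)))\<^sup>2)"
        by (intro Bochner_Integration.integral_nonneg) simp
      with bound[OF T rand[rule_format, OF T]]
      show "norm (prob_space.expectation (M T)
          (\<lambda>\<omega>. (norm (gradient F (smg_output f n \<beta> \<eta> w0 (\<pi> T) (\<tau> T) \<omega>)))\<^sup>2))
        \<le> 1 * norm ((C1 + C2 * ln (real T - 1 + lam))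
          / ((real T + lam) powr (2 / 3) - (1 + lam) powr (2 / 3)))"
        by (simp only: real_norm_def mult_1)
    qed
    then show "(\<lambda>T. prob_space.expectation (M T)
          (\<lambda>\<omega>. (norm (gradient F (smg_output f n \<beta> \<eta> w0 (\<pi> T) (\<tau> T) \<omega>)))\<^sup>2))
        \<in> O(\<lambda>T. real T powr (-2 / 3) * ln (real T))"
      by (rule landau_o.big_trans[OF _ rate_bigo[OF lam]])
  qed (rule bound)
qed

end
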